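(* Let $k$ be a reflection for a right-non-degenerate (RND) involutive solution $(X,r)$, and let $\varphi,\psi\colon X\to X$ be two maps such that, for all $a\in X$, $$\varphi\lambda_a=\lambda_a\varphi,\quad \rho_{\varphi(a)}=\rho_a,\qquad \psi\lambda_a=\lambda_a\psi,\quad \rho_{\psi(a)}=\rho_a.$$ Then $$r^{(k)}(\psi\times\psi)=(\psi\times\psi)\,r^{(\varphi k\psi)}$$ as maps $X\times X\to X\times X$.
   Context: For a map $\phi\colon X^m\to X^m$, $\phi_i$ denotes the map on $X^n$ that applies $\phi$ to the $m$ consecutive coordinates starting at position $i$ and is the identity on the others; products of maps denote composition, the rightmost map being applied first. A solution $(X,r)$ is a set $X$ with a map $r\colon X\times X\to X\times X$ satisfying the Yang–Baxter equation $r_1r_2r_1=r_2r_1r_2$ on $X^3$; write $r(a,b)=(\lambda_a(b),\rho_b(a))$. It is right-non-degenerate (RND) if all maps $\rho_b\colon X\to X$ are bijective, and involutive if $r^2=\mathrm{Id}$. A reflection for $(X,r)$ is a map $k\colon X\to X$ with $r k_2 r k_2=k_2 r k_2 r$ on $X^2$. Under the hypotheses of the claim, $\varphi k\psi$ is again a reflection for $(X,r)$. For an RND solution and a reflection $k$, the $k$-derived solution is the map $r^{(k)}\colon X\times X\to X\times X$, $r^{(k)}(a,b)=(b',a')$, where $a'=\rho_b\rho_{k(b)}^{-1}(a)$ and $b'=\rho_{k(a')}\lambda_{\rho_{k(b)}^{-1}(a)}(b)$. The map $r^{(\varphi k\psi)}$ is given by the same formula with $k$ replaced by $\varphi k\psi$.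 *)

theory Defs
  imports Main
begin

text \<open>
  The underlying set \<open>X\<close> is the universe of the type \<^typ>\<open>'a\<close>; the powers \<open>X\<^sup>2\<close> and \<open>X\<^sup>3\<close> are
  \<^typ>\<open>'a \<times> 'a\<close> and \<^typ>\<open>'a \<times> 'a \<times> 'a\<close>.
\<close>

definition r_one :: "('a \<times> 'a \<Rightarrow> 'a \<times> 'a) \<Rightarrow> 'a \<times> 'a \<times> 'a \<Rightarrow> 'a \<times> 'a \<times> 'a" where
  "r_one r = (\<lambda>(a, b, c). let (x, y) = r (a, b) in (x, y, c))"

definition r_two :: "('a \<times> 'a \<Rightarrow> 'a \<times> 'a) \<Rightarrow> 'a \<times> 'a \<times> 'a \<Rightarrow> 'a \<times> 'a \<times> 'a" where
  "r_two r = map_prod id r"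

definition k_two :: "('a \<Rightarrow> 'a) \<Rightarrow> 'a \<times> 'a \<Rightarrow> 'a \<times> 'a" where
  "k_two k = map_prod id k"

definition ybe_solution :: "('a \<times> 'a \<Rightarrow> 'a \<times> 'a) \<Rightarrow> bool" where
  "ybe_solution r \<longleftrightarrow> r_one r \<circ> r_two r \<circ> r_one r = r_two r \<circ> r_one r \<circ> r_two r"

text \<open>
  \<open>r (a, b) = (lam r a b, rho r b a)\<close>. The subscript is the first argument after \<open>r\<close>, so
  \<open>rho r b\<close> is the map \<open>\<rho>\<^sub>b\<close>.
\<close>

definition lam :: "('a \<times> 'a \<Rightarrow> 'a \<times> 'a) \<Rightarrow> 'a \<Rightarrow> 'a \<Rightarrow> 'a" where
  "lam r a b = fst (r (a, b))"

definition rho :: "('a \<times> 'a \<Rightarrow> 'a \<times> 'a) \<Rightarrow> 'a \<Rightarrow> 'a \<Rightarrow> 'a" where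
  "rho r b a = snd (r (a, b))"

definition right_non_degenerate :: "('a \<times> 'a \<Rightarrow> 'a \<times> 'a) \<Rightarrow> bool" where
  "right_non_degenerate r \<longleftrightarrow> (\<forall>b. bij (rho r b))"

definition involutive :: "('a \<times> 'a \<Rightarrow> 'a \<times> 'a) \<Rightarrow> bool" where
  "involutive r \<longleftrightarrow> r \<circ> r = id"

definition reflection :: "('a \<times> 'a \<Rightarrow> 'a \<times> 'a) \<Rightarrow> ('a \<Rightarrow> 'a) \<Rightarrow> bool" where
  "reflection r k \<longleftrightarrow> r \<circ> k_two k \<circ> r \<circ> k_two k = k_two k \<circ> r \<circ> k_two k \<circ> r"

text \<open>The inverses below are genuine only when \<open>r\<close> is right-non-degenerate.\<close>

definition derived :: "('a \<times> 'a \<Rightarrow> 'a \<times> 'a) \<Rightarrow> ('a \<Rightarrow> 'a) \<Rightarrow> 'a \<times> 'a \<Rightarrow> 'a \<times> 'a" where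
  "derived r k = (\<lambda>(a, b).
     let a' = rho r b (inv (rho r (k b)) a);
         b' = rho r (k a') (lam r (inv (rho r (k b)) a) b)
     in (b', a'))"

end

theory Submission
  imports Defs
begin

text \<open>
  Involutivity and right non-degeneracy determine \<open>\<lambda>\<close> from \<open>\<rho>\<close>: reading \<open>r (r (a, b)) = (a, b)\<close> in
  the second component gives \<open>\<lambda>\<^sub>a(b) = \<rho>\<^sub>c\<^sup>-\<^sup>1(b)\<close> with \<open>c = \<rho>\<^sub>b(a)\<close>. Let \<open>\<psi>\<close> commute with all
  \<open>\<lambda>\<^sub>a\<close> and satisfy \<open>\<rho>\<^bsub>\<psi>(a)\<^esub> = \<rho>\<^sub>a\<close>. The formula transfers these two properties between the two
  families: \<open>\<psi>\<close> also commutes with all \<open>\<rho>\<^sub>a\<close> (\<open>rho_commute\<close>), and \<open>\<lambda>\<^bsub>\<psi>(a)\<^esub> = \<lambda>\<^sub>a\<close>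
  (\<open>lam_invariant\<close>).

  Every operation in the derived solution is a \<open>\<lambda>\<close>, a \<open>\<rho>\<close> or an inverse \<open>\<rho>\<close>. Hence \<open>\<psi>\<close> can be
  pulled out of the arguments and dropped from the subscripts, except below \<open>k\<close>, where
  \<open>k \<circ> \<psi>\<close> remains. The subscript \<open>k \<circ> \<psi>\<close> may be replaced by \<open>\<phi> \<circ> k \<circ> \<psi>\<close>, because \<open>\<rho>\<close> does not see
  \<open>\<phi>\<close>. Both sides then agree componentwise.
\<close>

lemma involutive_rho_lam:
  assumes "involutive r"
  shows "rho r (rho r b a) (lam r a b) = b"
proof -
  have "r (r (a, b)) = (a, b)"
    using assms by (metis comp_apply id_apply involutive_def)
  then show ?thesis
    by (simp add: rho_def lam_def)
qed

lemma lam_eq_inv_rho: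
  assumes "right_non_degenerate r" and "involutive r"
  shows "lam r a b = inv (rho r (rho r b a)) b"
proof -
  have "bij (rho r (rho r b a))"
    using assms(1) by (simp add: right_non_degenerate_def)
  then show ?thesis
    using involutive_rho_lam[OF assms(2), of b a] by (metis bij_inv_eq_iff)
qed

text \<open>
  Substituting \<open>a = \<rho>\<^sub>b\<^sup>-\<^sup>1(c)\<close> in \<open>lam_eq_inv_rho\<close> writes \<open>\<rho>\<^sub>c\<^sup>-\<^sup>1(b)\<close> as \<open>\<lambda>\<^sub>a(b)\<close>. The subscript \<open>a\<close>
  depends on \<open>b\<close> only through \<open>\<rho>\<^sub>b\<close>, so it is the same for \<open>\<psi>(b)\<close>; commuting with \<open>\<lambda>\<^sub>a\<close> is
  therefore enough.
\<close>

lemma inv_rho_commute: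
  assumes rnd: "right_non_degenerate r" and inv: "involutive r"
    and comm: "\<And>a. \<psi> \<circ> lam r a = lam r a \<circ> \<psi>"
    and rho: "\<And>a. rho r (\<psi> a) = rho r a"
  shows "inv (rho r c) (\<psi> b) = \<psi> (inv (rho r c) b)"
proof -
  define a where "a = inv (rho r b) c"
  have c: "rho r b a = c"
    using rnd unfolding a_def right_non_degenerate_def by (metis bij_inv_eq_iff)
  have "inv (rho r c) (\<psi> b) = lam r a (\<psi> b)"
    by (simp add: lam_eq_inv_rho[OF rnd inv] rho c)
  also have "\<dots> = \<psi> (lam r a b)"
    using comm by (metis comp_apply)
  also have "\<dots> = \<psi> (inv (rho r c) b)"
    by (simp add: lam_eq_inv_rho[OF rnd inv] c)
  finally show ?thesis .
qed

lemma rho_commute: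
  assumes rnd: "right_non_degenerate r" and "involutive r"
    and "\<And>a. \<psi> \<circ> lam r a = lam r a \<circ> \<psi>"
    and "\<And>a. rho r (\<psi> a) = rho r a"
  shows "rho r c (\<psi> b) = \<psi> (rho r c b)"
proof -
  have bij: "bij (rho r c)"
    using rnd by (simp add: right_non_degenerate_def)
  have "inv (rho r c) (\<psi> (rho r c b)) = \<psi> b"
    using bij by (simp add: inv_rho_commute[OF assms] bij_is_inj)
  then show ?thesis
    using bij by (metis bij_inv_eq_iff)
qed

text \<open>
  By \<open>lam_eq_inv_rho\<close>, \<open>\<lambda>\<^sub>a\<close> depends on \<open>a\<close> only through \<open>\<rho>\<close> with subscript \<open>\<rho>\<^sub>b(a)\<close>. Replacing \<open>a\<close>
  by \<open>\<psi>(a)\<close> turns this subscript into \<open>\<psi>(\<rho>\<^sub>b(a))\<close>, which gives the same map.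
\<close>

lemma lam_invariant:
  assumes rnd: "right_non_degenerate r" and inv: "involutive r"
    and comm: "\<And>a. \<psi> \<circ> lam r a = lam r a \<circ> \<psi>"
    and rho: "\<And>a. rho r (\<psi> a) = rho r a"
  shows "lam r (\<psi> a) b = lam r a b"
  by (simp add: lam_eq_inv_rho[OF rnd inv] rho_commute[OF assms] rho)

theorem proposition3p9:
  fixes r :: "'a \<times> 'a \<Rightarrow> 'a \<times> 'a" and k \<phi> \<psi> :: "'a \<Rightarrow> 'a"
  assumes "ybe_solution r"
    and "right_non_degenerate r"
    and "involutive r"
    and "reflection r k"
    and "\<And>a. \<phi> \<circ> lam r a = lam r a \<circ> \<phi>"
    and "\<And>a. rho r (\<phi> a) = rho r a"
    and "\<And>a. \<psi> \<circ> lam r a = lam r a \<circ> \<psi>"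
    and "\<And>a. rho r (\<psi> a) = rho r a"
  shows "derived r k \<circ> map_prod \<psi> \<psi> = map_prod \<psi> \<psi> \<circ> derived r (\<phi> \<circ> k \<circ> \<psi>)"
proof -
  note psi = assms(2,3,7,8)
  have lam_comm: "lam r a (\<psi> b) = \<psi> (lam r a b)" for a b
    using assms(7) by (metis comp_apply)
  show ?thesis
    by (simp add: fun_eq_iff derived_def Let_def assms(6,8) lam_comm
        inv_rho_commute[OF psi] rho_commute[OF psi] lam_invariant[OF psi])
qed

end
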